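(* Let $n$ be a positive integer. Then $$\zeta(2n+1)=(-1)^{n+1}\int_{[0,1]^n}\left(\prod_{i=1}^{n}\frac{\log(x_i)}{x_i}\right)\log\left(1-\prod_{i=1}^n x_i\right)\,dx_1\cdots dx_n .$$
   Context: $\zeta$ denotes the Riemann zeta function, and $\log$ is the natural logarithm. The integrand is defined on the open hypercube $]0,1[^n$, and the integral over $[0,1]^n$ is understood as a generalized (improper) integral. *)

theory Defs
  imports "HOL-Analysis.Analysis"
begin

definition zeta_series :: "complex \<Rightarrow> complex" where
  "zeta_series s = (\<Sum>k. 1 / of_nat (Suc k) powr s)"

text \<open>
  The second branch is the analytic continuation to \<open>s \<noteq> 1\<close>, which is unique by the identity
  theorem. At the pole \<open>s = 1\<close> the description is not unique and the value is unspecified.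
\<close>

definition riemann_zeta :: "complex \<Rightarrow> complex" where
  "riemann_zeta s =
     (if Re s > 1 then zeta_series s
      else (THE w. \<exists>f. f holomorphic_on (- {1}) \<and>
                       (\<forall>z. Re z > 1 \<longrightarrow> f z = zeta_series z) \<and> w = f s))"

text \<open>
  Points \<open>(x\<^sub>1, \<dots>, x\<^sub>n)\<close> are functions on the index set \<open>{1..n}\<close>, and
  \<open>n\<close>-dimensional Lebesgue measure is the \<open>n\<close>-fold product of \<^const>\<open>lborel\<close>.
  The open cube, on which the integrand is defined, differs from \<open>[0,1]\<^sup>n\<close> by a null set.
\<close>

abbreviation lebesgue_n :: "nat \<Rightarrow> (nat \<Rightarrow> real) measure" where
  "lebesgue_n n \<equiv> (\<Pi>\<^sub>M i\<in>{1..n}. lborel)"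

definition open_cube :: "nat \<Rightarrow> (nat \<Rightarrow> real) set" where
  "open_cube n = (\<Pi>\<^sub>E i\<in>{1..n}. {0<..<1})"

definition integrand :: "nat \<Rightarrow> (nat \<Rightarrow> real) \<Rightarrow> real" where
  "integrand n x = (\<Prod>i=1..n. ln (x i) / x i) * ln (1 - (\<Prod>i=1..n. x i))"

end

theory Submission
  imports Defs "HOL-Real_Asymp.Real_Asymp"
begin

text \<open>
  With $P = x_1 \cdots x_n$, the Mercator series $- \log (1 - P) = \sum_{k \ge 0} P^{k+1} / (k+1)$
  splits the integrand, up to the sign $(-1)^{n+1}$, into
  $\sum_{k \ge 0} \frac{1}{k+1} \prod_i (- \log x_i) \, x_i^k$.
  Each summand has separated variables, so its integral over the cube is the product of $n$ copies of
  $\int_0^1 (- \log y) \, y^k \, dy = 1 / (k+1)^2$, and the summands integrate to $1 / (k+1)^{2n+1}$.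

  All summands are nonnegative on the cube. The argument is therefore carried out with nonnegative
  integrals, where sum and integral commute unconditionally; the finiteness of the resulting zeta
  series then yields integrability along with the value.
\<close>

text \<open>
  An antiderivative of $- y^k \log y$ is
  $\frac{y^{k+1}}{(k+1)^2} - \frac{y^{k+1} \log y}{k+1}$. The integral is improper at 0 when
  $k = 0$, so only the limits of the antiderivative at the endpoints enter.
\<close>

lemma nn_integral_neg_ln_times_power:
  "(\<integral>\<^sup>+y. ennreal (indicator {0<..<1} y * (- ln y * y ^ k)) \<partial>lborel) = ennreal (1 / real (Suc k) ^ 2)"
proof -
  define f where "f = (\<lambda>y::real. - ln y * y ^ k)"
  define F where "F = (\<lambda>y::real. y ^ Suc k / real (Suc k) ^ 2 - y ^ Suc k * ln y / real (Suc k))"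
  have deriv: "(F has_real_derivative f y) (at y)" if "0 < y" for y
  proof -
    have "(F has_real_derivative real (Suc k) * y ^ k / real (Suc k) ^ 2
        - (real (Suc k) * y ^ k * ln y + 1 / y * y ^ Suc k) / real (Suc k)) (at y)"
      unfolding F_def using that DERIV_pow[of "Suc k" y UNIV]
      by (intro DERIV_diff DERIV_cdivide DERIV_mult DERIV_ln_divide) simp_all
    moreover have "real (Suc k) * y ^ k / real (Suc k) ^ 2
        - (real (Suc k) * y ^ k * ln y + 1 / y * y ^ Suc k) / real (Suc k) = f y"
      unfolding f_def using that
      by (simp add: add_divide_distrib power2_eq_square del: of_nat_Suc)
    ultimately show ?thesis by simp
  qed
  have xlnx: "((\<lambda>y::real. y * ln y) \<longlongrightarrow> 0) (at_right 0)"
    by real_asymp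
  have "((\<lambda>y. y ^ Suc k / real (Suc k) ^ 2 - y ^ k * (y * ln y) / real (Suc k)) \<longlongrightarrow>
           0 ^ Suc k / real (Suc k) ^ 2 - 0 ^ k * 0 / real (Suc k)) (at_right 0)"
    by (intro tendsto_intros xlnx) auto
  then have lim0: "(F \<longlongrightarrow> 0) (at_right 0)"
    by (simp add: F_def mult_ac)
  have "isCont F 1"
    using deriv[of 1] DERIV_isCont by auto
  then have lim1: "(F \<longlongrightarrow> 1 / real (Suc k) ^ 2) (at_left 1)"
    by (auto simp: F_def isCont_def intro: filterlim_at_within_not_equal tendsto_within_subset)
  have nonneg: "0 \<le> f y" if "0 < y" "y < 1" for y
    using that by (auto simp: f_def mult_nonneg_nonneg mult_nonpos_nonneg)
  have cont: "isCont f y" if "0 < y" for y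
    unfolding f_def using that by (intro continuous_intros) auto
  note FTC = interval_integral_FTC_nonneg[of "ereal 0" "ereal 1" F f 0 "1 / real (Suc k) ^ 2"]
  have "set_integrable lborel (einterval (ereal 0) (ereal 1)) f"
    using lim0 lim1 deriv cont nonneg
    by (intro FTC) (auto simp: ereal_tendsto_simps zero_ereal_def one_ereal_def)
  then have int: "integrable lborel (\<lambda>y. indicator {0<..<1} y * f y)"
    by (simp add: set_integrable_def)
  have "(LBINT y=ereal 0..ereal 1. f y) = 1 / real (Suc k) ^ 2 - 0"
    using lim0 lim1 deriv cont nonneg
    by (intro FTC) (auto simp: ereal_tendsto_simps zero_ereal_def one_ereal_def)
  then have "(\<integral>y. indicator {0<..<1} y * f y \<partial>lborel) = 1 / real (Suc k) ^ 2"
    by (simp add: interval_lebesgue_integral_def set_lebesgue_integral_def)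
  then show ?thesis
    using nn_integral_eq_integral[OF int] nonneg
    by (auto simp: f_def indicator_def)
qed

lemma neg_ln_one_minus_sums:
  fixes p :: real
  assumes "0 \<le> p" "p < 1"
  shows "(\<lambda>k. p ^ Suc k / real (Suc k)) sums (- ln (1 - p))"
proof -
  have "(\<lambda>k. - (- (p ^ k / real k))) sums (- ln (1 + - p))"
    using sums_minus[OF ln_series'[of "- p"]] assms by simp
  then show ?thesis
    by (subst sums_Suc_iff) simp
qed

lemma indicator_open_cube:
  assumes "x \<in> space (lebesgue_n n)"
  shows "indicator (open_cube n) x = (\<Prod>i=1..n. indicator {0<..<1} (x i) :: real)"
proof (cases "x \<in> open_cube n")
  case True
  then show ?thesis by (auto simp: open_cube_def PiE_iff)
next
  case False
  then obtain i where "i \<in> {1..n}" "x i \<notin> {0<..<1}"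
    using assms by (auto simp: open_cube_def PiE_iff space_PiM)
  with False show ?thesis
    by (auto simp: indicator_def intro!: prod_zero[symmetric] bexI[of _ i])
qed

text \<open>
  The factor $1 / x_i$ of the integrand lowers the exponent $k + 1$ of the Mercator series to $k$.
  The sign collects one $-1$ from each $\log x_i$ and one from the series itself. Strict
  positivity of \<open>n\<close> matters: for the empty product the logarithm is evaluated at 0.
\<close>

lemma integrand_sums:
  assumes "n \<ge> 1" "x \<in> open_cube n"
  shows "(\<lambda>k. (\<Prod>i=1..n. - ln (x i) * x i ^ k) / real (Suc k)) sums ((- 1) ^ (n + 1) * integrand n x)"
proof -
  define P where "P = (\<Prod>i=1..n. x i)"
  have x: "0 < x i" "x i < 1" if "i \<in> {1..n}" for i
    using assms(2) that by (auto simp: open_cube_def PiE_iff)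
  have "0 \<le> P"
    unfolding P_def using x by (intro prod_nonneg) (auto intro: less_imp_le)
  have "P < (\<Prod>i=1..n. 1)"
    unfolding P_def using x assms(1) by (intro prod_mono_strict) (auto intro: less_imp_le)
  then have "P < 1" by simp
  have "(\<lambda>k. (\<Prod>i=1..n. - (ln (x i) / x i)) * (P ^ Suc k / real (Suc k))) sums
          ((\<Prod>i=1..n. - (ln (x i) / x i)) * - ln (1 - P))"
    by (intro sums_mult neg_ln_one_minus_sums \<open>0 \<le> P\<close> \<open>P < 1\<close>)
  moreover have "(\<Prod>i=1..n. - (ln (x i) / x i)) * P ^ Suc k = (\<Prod>i=1..n. - ln (x i) * x i ^ k)" for k
    unfolding P_def prod_power_distrib prod.distrib[symmetric] using x
    by (intro prod.cong) (auto simp: less_imp_neq)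
  moreover have "(\<Prod>i=1..n. - (ln (x i) / x i)) * - ln (1 - P) = (- 1) ^ (n + 1) * integrand n x"
    unfolding integrand_def P_def using prod.distrib[of "\<lambda>_. - 1" "\<lambda>i. ln (x i) / x i" "{1..n}"]
    by simp
  ultimately show ?thesis
    by (simp add: times_divide_eq_right)
qed

lemma nn_integral_expansion_term:
  "(\<integral>\<^sup>+x. ennreal (indicator (open_cube n) x * ((\<Prod>i=1..n. - ln (x i) * x i ^ k) / real (Suc k)))
     \<partial>lebesgue_n n) = ennreal (1 / real (Suc k) ^ (2 * n + 1))"
proof -
  interpret product_sigma_finite "\<lambda>_::nat. lborel :: real measure" ..
  define g where "g = (\<lambda>y::real. indicator {0<..<1} y * (- ln y * y ^ k))"
  have nonneg: "0 \<le> g y" for y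
    by (auto simp: g_def indicator_def mult_nonpos_nonneg)
  have [measurable]: "g \<in> borel_measurable borel"
    unfolding g_def by measurable
  have "ennreal (indicator (open_cube n) x * ((\<Prod>i=1..n. - ln (x i) * x i ^ k) / real (Suc k))) =
      ennreal (1 / real (Suc k)) * (\<Prod>i=1..n. ennreal (g (x i)))" if "x \<in> space (lebesgue_n n)" for x
  proof -
    have "(\<Prod>i=1..n. g (x i)) = indicator (open_cube n) x * (\<Prod>i=1..n. - ln (x i) * x i ^ k)"
      by (simp only: indicator_open_cube[OF that] g_def prod.distrib)
    then have "indicator (open_cube n) x * ((\<Prod>i=1..n. - ln (x i) * x i ^ k) / real (Suc k)) =
        1 / real (Suc k) * (\<Prod>i=1..n. g (x i))"
      by (simp only: times_divide_eq_left times_divide_eq_right mult_1)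
    then show ?thesis
      using nonneg by (simp only: ennreal_mult prod_nonneg prod_ennreal divide_nonneg_nonneg
          zero_le_one of_nat_0_le_iff)
  qed
  then have "(\<integral>\<^sup>+x. ennreal (indicator (open_cube n) x *
        ((\<Prod>i=1..n. - ln (x i) * x i ^ k) / real (Suc k))) \<partial>lebesgue_n n) =
      (\<integral>\<^sup>+x. ennreal (1 / real (Suc k)) * (\<Prod>i=1..n. ennreal (g (x i))) \<partial>lebesgue_n n)"
    by (intro nn_integral_cong)
  also have "\<dots> = ennreal (1 / real (Suc k)) * (\<integral>\<^sup>+x. (\<Prod>i=1..n. ennreal (g (x i))) \<partial>lebesgue_n n)"
    by (intro nn_integral_cmult) measurable
  also have "(\<integral>\<^sup>+x. (\<Prod>i=1..n. ennreal (g (x i))) \<partial>lebesgue_n n) =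
      (\<Prod>i=1..n. \<integral>\<^sup>+y. ennreal (g y) \<partial>lborel)"
    by (intro product_nn_integral_prod) auto
  also have "\<dots> = ennreal (1 / real (Suc k) ^ 2) ^ n"
    using nn_integral_neg_ln_times_power[of k] by (simp add: g_def del: of_nat_Suc)
  finally show ?thesis
    by (simp add: ennreal_power ennreal_mult[symmetric] power_mult power_divide del: of_nat_Suc)
qed

text \<open>
  Nonnegativity of the summands allows the series to be integrated termwise, and a nonnegative
  function with finite integral is integrable.
\<close>

lemma has_bochner_integral_signed_integrand:
  assumes "n \<ge> 1"
  shows "has_bochner_integral (lebesgue_n n)
           (\<lambda>x. indicator (open_cube n) x * ((- 1) ^ (n + 1) * integrand n x))
           (\<Sum>k. 1 / real (Suc k) ^ (2 * n + 1))"
proof (rule has_bochner_integral_nn_integral)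
  define t where "t = (\<lambda>k x. indicator (open_cube n) x *
    ((\<Prod>i=1..n. - ln (x i) * x i ^ k) / real (Suc k)))"
  have cube [measurable]: "open_cube n \<in> sets (lebesgue_n n)"
    unfolding open_cube_def by (intro sets_PiM_I_finite) auto
  have t_meas [measurable]: "t k \<in> borel_measurable (lebesgue_n n)" for k
    unfolding t_def by measurable
  show "(\<lambda>x. indicator (open_cube n) x * ((- 1) ^ (n + 1) * integrand n x)) \<in> borel_measurable (lebesgue_n n)"
    unfolding integrand_def by measurable
  have t_nonneg: "0 \<le> t k x" for k x
  proof (cases "x \<in> open_cube n")
    case True
    then have "0 \<le> - ln (x i) * x i ^ k" if "i \<in> {1..n}" for i
      using that by (intro mult_nonneg_nonneg) (auto simp: open_cube_def PiE_iff intro: less_imp_le)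
    then show ?thesis
      unfolding t_def by (intro mult_nonneg_nonneg[OF indicator_pos_le] divide_nonneg_nonneg prod_nonneg of_nat_0_le_iff)
  qed (simp add: t_def)
  have t_sums: "(\<lambda>k. t k x) sums (indicator (open_cube n) x * ((- 1) ^ (n + 1) * integrand n x))" for x
    using integrand_sums[OF assms, of x] by (cases "x \<in> open_cube n") (simp_all add: t_def)
  have "0 \<le> indicator (open_cube n) x * ((- 1) ^ (n + 1) * integrand n x)" for x
    by (rule sums_le[OF t_nonneg sums_zero t_sums])
  then show "AE x in lebesgue_n n. 0 \<le> indicator (open_cube n) x * ((- 1) ^ (n + 1) * integrand n x)"
    by (rule AE_I2)
  have summable: "summable (\<lambda>k. 1 / real (Suc k) ^ (2 * n + 1))"
    using inverse_power_summable[of "2 * n + 1", where 'a = real] assms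
    by (subst summable_Suc_iff) (simp add: inverse_eq_divide)
  then show "0 \<le> (\<Sum>k. 1 / real (Suc k) ^ (2 * n + 1))"
    by (intro suminf_nonneg) auto
  have "(\<integral>\<^sup>+x. ennreal (indicator (open_cube n) x * ((- 1) ^ (n + 1) * integrand n x)) \<partial>lebesgue_n n) =
      (\<integral>\<^sup>+x. (\<Sum>k. ennreal (t k x)) \<partial>lebesgue_n n)"
    by (intro nn_integral_cong)
       (simp only: suminf_ennreal2[OF t_nonneg sums_summable[OF t_sums]] sums_unique[OF t_sums, symmetric])
  also have "\<dots> = (\<Sum>k. \<integral>\<^sup>+x. ennreal (t k x) \<partial>lebesgue_n n)"
    by (intro nn_integral_suminf) measurable
  also have "\<dots> = (\<Sum>k. ennreal (1 / real (Suc k) ^ (2 * n + 1)))"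
    by (simp only: t_def nn_integral_expansion_term)
  also have "\<dots> = ennreal (\<Sum>k. 1 / real (Suc k) ^ (2 * n + 1))"
    using summable by (intro suminf_ennreal2) auto
  finally show "(\<integral>\<^sup>+x. ennreal (indicator (open_cube n) x * ((- 1) ^ (n + 1) * integrand n x))
      \<partial>lebesgue_n n) = ennreal (\<Sum>k. 1 / real (Suc k) ^ (2 * n + 1))" .
qed

lemma riemann_zeta_of_nat:
  assumes "m > 1"
  shows "riemann_zeta (of_nat m) = of_real (\<Sum>k. 1 / real (Suc k) ^ m)"
proof -
  have "summable (\<lambda>k. 1 / real (Suc k) ^ m)"
    using inverse_power_summable[of m, where 'a = real] assms
    by (subst summable_Suc_iff) (simp add: inverse_eq_divide)
  then have "(\<Sum>k. complex_of_real (1 / real (Suc k) ^ m)) = of_real (\<Sum>k. 1 / real (Suc k) ^ m)"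
    by (rule suminf_of_real[symmetric])
  moreover have "complex_of_real (1 / real (Suc k) ^ m) = 1 / of_nat (Suc k) powr of_nat m" for k
    by (simp add: powr_nat' del: of_nat_Suc)
  ultimately show ?thesis
    using assms by (simp add: riemann_zeta_def zeta_series_def)
qed

theorem theorem2p1:
  fixes n :: nat
  assumes "n \<ge> 1"
  shows "set_integrable (lebesgue_n n) (open_cube n) (integrand n) \<and>
         riemann_zeta (of_nat (2 * n + 1)) =
           of_real ((- 1) ^ (n + 1) * (LINT x:open_cube n|lebesgue_n n. integrand n x))"
proof -
  define S where "S = (\<Sum>k. 1 / real (Suc k) ^ (2 * n + 1))"
  have sign: "(- 1) ^ (n + 1) * ((- 1) ^ (n + 1) * a) = a" for a :: real
    by (simp add: mult.assoc[symmetric] flip: power_mult_distrib)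
  have signs: "(- 1) ^ (n + 1) * (b * ((- 1) ^ (n + 1) * a)) = b * a" for a b :: real
    using sign[of a] by (simp only: mult.left_commute[of _ b])
  have "has_bochner_integral (lebesgue_n n)
      (\<lambda>x. (- 1) ^ (n + 1) * (indicator (open_cube n) x * ((- 1) ^ (n + 1) * integrand n x)))
      ((- 1) ^ (n + 1) * S)"
    unfolding S_def by (intro has_bochner_integral_mult_right has_bochner_integral_signed_integrand assms)
  also have "(\<lambda>x. (- 1) ^ (n + 1) * (indicator (open_cube n) x * ((- 1) ^ (n + 1) * integrand n x))) =
      (\<lambda>x. indicator (open_cube n) x *\<^sub>R integrand n x)"
    by (simp only: signs real_scaleR_def)
  finally have "set_integrable (lebesgue_n n) (open_cube n) (integrand n)"
    and "(LINT x:open_cube n|lebesgue_n n. integrand n x) = (- 1) ^ (n + 1) * S"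
    by (simp_all add: set_integrable_def set_lebesgue_integral_def has_bochner_integral_iff)
  moreover have "riemann_zeta (of_nat (2 * n + 1)) = of_real S"
    unfolding S_def using assms by (intro riemann_zeta_of_nat) simp
  ultimately show ?thesis
    by (simp only: sign simp_thms)
qed

end
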